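(* For every integer $n\geq 2$, $$p(n)=n+\sum_{k=3}^{n}(n-k+1)\gamma(k)=n+(n-2)\gamma(3)+(n-3)\gamma(4)+\cdots+2\gamma(n-1)+\gamma(n),$$ where the sum is empty (equal to $0$) if $n=2$.
   Context: $p(n)$ is the number of integer partitions of $n$. A nuclear partition is an integer partition with no part equal to $1$. $\gamma(n)$ denotes the number of nuclear partitions $\mu=(\mu_1,\mu_2,\dots,\mu_r)$ of $n$, with $\mu_1\geq\mu_2\geq\dots\geq\mu_r\geq2$ and $r\geq2$, such that $\mu_1=\mu_2$ (so the two largest parts are equal); $\gamma(0):=0$, and $\gamma(1)=\gamma(2)=\gamma(3)=0$. *)

theory Defs
  imports Main
begin

definition integer_partition :: "nat \<Rightarrow> nat list \<Rightarrow> bool" where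
  "integer_partition n \<mu> \<longleftrightarrow> sorted_wrt (\<ge>) \<mu> \<and> (\<forall>x\<in>set \<mu>. 1 \<le> x) \<and> sum_list \<mu> = n"

definition partition_number :: "nat \<Rightarrow> nat" where
  "partition_number n = card {\<mu>. integer_partition n \<mu>}"

definition nuclear_partition :: "nat \<Rightarrow> nat list \<Rightarrow> bool" where
  "nuclear_partition n \<mu> \<longleftrightarrow> integer_partition n \<mu> \<and> 1 \<notin> set \<mu>"

text \<open>Parts are listed in weakly decreasing order and indexed from 0, so the two largest
  parts are \<open>\<mu> ! 0\<close> and \<open>\<mu> ! 1\<close>.\<close>

definition gamma_number :: "nat \<Rightarrow> nat" where
  "gamma_number n = card {\<mu>. nuclear_partition n \<mu> \<and> 2 \<le> length \<mu> \<and> \<mu> ! 0 = \<mu> ! 1}"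

text \<open>The counted sets are finite, so the cardinalities are genuine counts.\<close>

lemma finite_integer_partitions: "finite {\<mu>. integer_partition n \<mu>}"
proof (rule finite_subset)
  show "{\<mu>. integer_partition n \<mu>} \<subseteq> {\<mu>. set \<mu> \<subseteq> {..n} \<and> length \<mu> \<le> n}"
  proof
    fix \<mu> assume "\<mu> \<in> {\<mu>. integer_partition n \<mu>}"
    then have pos: "\<forall>x\<in>set \<mu>. 1 \<le> x" and sum: "sum_list \<mu> = n"
      by (auto simp: integer_partition_def)
    have "length \<mu> \<le> sum_list \<mu>"
      using pos by (induction \<mu>) auto
    moreover have "set \<mu> \<subseteq> {..n}"
      using sum member_le_sum_list by auto
    ultimately show "\<mu> \<in> {\<mu>. set \<mu> \<subseteq> {..n} \<and> length \<mu> \<le> n}"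
      using sum by simp
  qed
  show "finite {\<mu>. set \<mu> \<subseteq> {..n} \<and> length \<mu> \<le> n}"
    by (rule finite_lists_length_le) simp
qed

text \<open>The values \<open>\<gamma>(0) = \<gamma>(1) = \<gamma>(2) = \<gamma>(3) = 0\<close> follow from the definition.\<close>

lemma gamma_number_eq_0: "n < 4 \<Longrightarrow> gamma_number n = 0"
proof -
  assume n: "n < 4"
  have "\<not> (nuclear_partition n \<mu> \<and> 2 \<le> length \<mu> \<and> \<mu> ! 0 = \<mu> ! 1)" for \<mu>
  proof
    assume A: "nuclear_partition n \<mu> \<and> 2 \<le> length \<mu> \<and> \<mu> ! 0 = \<mu> ! 1"
    then obtain a b \<nu> where \<mu>: "\<mu> = a # b # \<nu>"
      by (cases \<mu>; cases "tl \<mu>") auto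
    with A n show False
      by (auto simp: nuclear_partition_def integer_partition_def)
  qed
  then have "{\<mu>. nuclear_partition n \<mu> \<and> 2 \<le> length \<mu> \<and> \<mu> ! 0 = \<mu> ! 1} = {}"
    by blast
  then show ?thesis
    unfolding gamma_number_def by (simp only: card.empty)
qed

end

theory Submission
  imports Defs
begin

text \<open>Deleting a part equal to 1 gives \<open>p(n) - p(n-1) = \<nu>(n)\<close>, where \<open>\<nu>\<close> counts nuclear partitions.
  Decreasing the largest part by 1 turns the nuclear partitions of \<open>n \<ge> 3\<close> whose largest part is not
  repeated bijectively into the nuclear partitions of \<open>n - 1\<close>, so \<open>\<nu>(n) - \<nu>(n-1) = \<gamma>(n)\<close>.
  Summing twice gives the formula.\<close>

definition nuclear_number :: "nat \<Rightarrow> nat" where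
  "nuclear_number n = card {\<mu>. nuclear_partition n \<mu>}"

lemma finite_nuclear_partitions: "finite {\<mu>. nuclear_partition n \<mu>}"
  by (rule finite_subset[OF _ finite_integer_partitions[of n]])
     (auto simp: nuclear_partition_def)

lemma integer_partition_append_1:
  "integer_partition (Suc n) (\<mu> @ [1]) \<longleftrightarrow> integer_partition n \<mu>"
  by (auto simp: integer_partition_def sorted_wrt_append)

text \<open>Parts are weakly decreasing, so a part 1 forces the last entry to be at most 1, and
  positivity makes it exactly 1. Deleting a part 1 thus just undoes \<open>@ [1]\<close>.\<close>

lemma integer_partition_with_1E:
  assumes "integer_partition n \<mu>" "1 \<in> set \<mu>"
  obtains \<nu> where "\<mu> = \<nu> @ [1]"
proof -
  obtain \<nu> x where \<mu>: "\<mu> = \<nu> @ [x]"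
    using assms(2) by (cases \<mu> rule: rev_cases) auto
  then have "x \<le> 1" "1 \<le> x"
    using assms by (auto simp: integer_partition_def sorted_wrt_append)
  with \<mu> that show thesis by simp
qed

lemma integer_partitions_Suc:
  "{\<mu>. integer_partition (Suc n) \<mu>} =
     (\<lambda>\<mu>. \<mu> @ [1]) ` {\<mu>. integer_partition n \<mu>} \<union> {\<mu>. nuclear_partition (Suc n) \<mu>}"
  (is "?L = ?R")
proof
  show "?L \<subseteq> ?R"
  proof
    fix \<mu> assume "\<mu> \<in> ?L"
    then have \<mu>: "integer_partition (Suc n) \<mu>" by simp
    show "\<mu> \<in> ?R"
    proof (cases "1 \<in> set \<mu>")
      case True
      with \<mu> obtain \<nu> where "\<mu> = \<nu> @ [1]" by (rule integer_partition_with_1E)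
      with \<mu> show ?thesis using integer_partition_append_1 by blast
    next
      case False
      with \<mu> show ?thesis by (simp add: nuclear_partition_def)
    qed
  qed
  show "?R \<subseteq> ?L"
    using integer_partition_append_1 by (auto simp: nuclear_partition_def)
qed

lemma partition_number_Suc:
  "partition_number (Suc n) = partition_number n + nuclear_number (Suc n)"
proof -
  have "(\<lambda>\<mu>. \<mu> @ [1]) ` {\<mu>. integer_partition n \<mu>} \<inter> {\<mu>. nuclear_partition (Suc n) \<mu>} = {}"
    by (auto simp: nuclear_partition_def)
  moreover have "inj_on (\<lambda>\<mu>. \<mu> @ [1]) {\<mu>. integer_partition n \<mu>}"
    by (auto simp: inj_on_def)
  ultimately show ?thesis
    unfolding partition_number_def nuclear_number_def integer_partitions_Suc
    by (simp add: card_Un_disjoint finite_integer_partitions finite_nuclear_partitions card_image)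
qed

text \<open>Inverse of decreasing the largest part. This direction is injective on all lists,
  whereas truncated subtraction would identify the heads 0 and 1.\<close>

fun increment_head :: "nat list \<Rightarrow> nat list" where
  "increment_head [] = []"
| "increment_head (x # xs) = Suc x # xs"

lemma inj_increment_head: "inj increment_head"
proof (rule injI)
  fix xs ys assume "increment_head xs = increment_head ys"
  then show "xs = ys" by (cases xs; cases ys) auto
qed

lemma nuclear_partition_increment_head:
  assumes "nuclear_partition n \<mu>" "0 < n"
  shows "nuclear_partition (Suc n) (increment_head \<mu>)"
    and "\<not> (2 \<le> length (increment_head \<mu>) \<and> increment_head \<mu> ! 0 = increment_head \<mu> ! 1)"
proof -
  \<comment> \<open>The empty list, which \<open>increment_head\<close> would leave unchanged, is
    ruled out by \<open>0 < n\<close>.\<close>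
  obtain x xs where \<mu>: "\<mu> = x # xs"
    using assms by (cases \<mu>) (auto simp: nuclear_partition_def integer_partition_def)
  show "nuclear_partition (Suc n) (increment_head \<mu>)"
    using assms \<mu> by (auto simp: nuclear_partition_def integer_partition_def)
  show "\<not> (2 \<le> length (increment_head \<mu>) \<and> increment_head \<mu> ! 0 = increment_head \<mu> ! 1)"
    using assms \<mu> by (cases xs) (auto simp: nuclear_partition_def integer_partition_def)
qed

text \<open>Lowering the head by 1 keeps the order because the head strictly exceeds all other
  parts, and creates no part 1 because the head is at least 3. The bound on \<open>n\<close>
  excludes \<open>[2]\<close>, which would be lowered to \<open>[1]\<close>.\<close>

lemma nuclear_partition_unequal_headE:
  assumes "nuclear_partition (Suc n) \<mu>" "2 \<le> n"
    and "\<not> (2 \<le> length \<mu> \<and> \<mu> ! 0 = \<mu> ! 1)"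
  obtains \<nu> where "nuclear_partition n \<nu>" "\<mu> = increment_head \<nu>"
proof -
  obtain x xs where \<mu>: "\<mu> = x # xs"
    using assms(1) by (cases \<mu>) (auto simp: nuclear_partition_def integer_partition_def)
  \<comment> \<open>The second part, if any, differs from \<open>x\<close> and so is smaller;
    sortedness bounds all later parts by it.\<close>
  have gt: "\<forall>y\<in>set xs. y < x"
    using assms(1,3) \<mu> by (cases xs) (force simp: nuclear_partition_def integer_partition_def)+
  have ge2: "\<forall>y\<in>set \<mu>. 2 \<le> y"
    using assms(1) unfolding nuclear_partition_def integer_partition_def
    by (metis One_nat_def Suc_1 le_neq_implies_less less_eq_Suc_le)
  \<comment> \<open>A single part equals \<open>Suc n\<close>, which is at least 3; otherwise
    \<open>x\<close> strictly exceeds another part, itself at least 2.\<close>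
  have "3 \<le> x"
  proof (cases xs)
    case Nil
    with assms(1,2) \<mu> show ?thesis by (simp add: nuclear_partition_def integer_partition_def)
  next
    case (Cons y ys)
    with gt ge2 \<mu> show ?thesis by fastforce
  qed
  then have "nuclear_partition n ((x - 1) # xs)"
    using assms(1) \<mu> gt by (auto simp: nuclear_partition_def integer_partition_def)
  moreover have "\<mu> = increment_head ((x - 1) # xs)"
    using \<mu> \<open>3 \<le> x\<close> by simp
  ultimately show thesis by (rule that)
qed

lemma nuclear_number_Suc:
  assumes "2 \<le> n"
  shows "nuclear_number (Suc n) = nuclear_number n + gamma_number (Suc n)"
proof -
  let ?N = "{\<mu>. nuclear_partition n \<mu>}"
  let ?G = "{\<mu>. nuclear_partition (Suc n) \<mu> \<and> 2 \<le> length \<mu> \<and> \<mu> ! 0 = \<mu> ! 1}"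
  \<comment> \<open>The image consists exactly of the nuclear partitions whose largest part is not
    repeated; \<open>?G\<close> holds the others.\<close>
  have "{\<mu>. nuclear_partition (Suc n) \<mu>} = increment_head ` ?N \<union> ?G"
    using assms nuclear_partition_increment_head(1)[of n] nuclear_partition_unequal_headE[of n]
    by fastforce
  moreover have "increment_head ` ?N \<inter> ?G = {}"
    using assms nuclear_partition_increment_head(2)[of n] by fastforce
  moreover have "finite ?G"
    by (rule finite_subset[OF _ finite_nuclear_partitions[of "Suc n"]]) auto
  ultimately show ?thesis
    unfolding nuclear_number_def gamma_number_def
    by (simp add: card_Un_disjoint finite_nuclear_partitions card_image
          inj_on_subset[OF inj_increment_head])
qed

lemma nuclear_number_1: "nuclear_number (Suc 0) = 0"
proof -
  have "\<not> nuclear_partition (Suc 0) \<mu>" for \<mu>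
    by (cases \<mu>) (auto simp: nuclear_partition_def integer_partition_def)
  then show ?thesis by (simp add: nuclear_number_def)
qed

lemma nuclear_number_2: "nuclear_number 2 = 1"
proof -
  have "nuclear_partition 2 \<mu> \<longleftrightarrow> \<mu> = [2]" for \<mu>
  proof
    assume A: "nuclear_partition 2 \<mu>"
    then obtain x xs where \<mu>: "\<mu> = x # xs"
      by (cases \<mu>) (auto simp: nuclear_partition_def integer_partition_def)
    with A have "1 \<le> x" "x \<noteq> 1" "x + sum_list xs = 2" "\<forall>y\<in>set xs. 1 \<le> y"
      by (auto simp: nuclear_partition_def integer_partition_def)
    \<comment> \<open>Since \<open>x\<close> is at least 2, the tail sums to 0; its parts are
      positive, so it is empty.\<close>
    with \<mu> show "\<mu> = [2]" by (cases xs) auto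
  qed (auto simp: nuclear_partition_def integer_partition_def)
  then show ?thesis by (simp add: nuclear_number_def)
qed

lemma partition_number_0: "partition_number 0 = 1"
proof -
  have "integer_partition 0 \<mu> \<longleftrightarrow> \<mu> = []" for \<mu>
    by (cases \<mu>) (auto simp: integer_partition_def)
  then show ?thesis by (simp add: partition_number_def)
qed

lemma partition_number_2: "partition_number 2 = 2"
  using nuclear_number_2
  by (simp add: numeral_2_eq_2 partition_number_Suc partition_number_0 nuclear_number_1)

text \<open>The recurrence telescopes down to \<open>nuclear_number 2 = 1\<close>, which is the
  constant term; its first application, at 2, contributes \<open>gamma_number 3\<close>.\<close>

lemma nuclear_number_eq_sum_gamma:
  assumes "2 \<le> n"
  shows "nuclear_number n = 1 + (\<Sum>k=3..n. gamma_number k)"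
  using assms
proof (induction n rule: dec_induct)
  case base
  show ?case by (simp add: nuclear_number_2)
next
  case (step n)
  then show ?case by (simp add: nuclear_number_Suc)
qed

theorem mainTheorem4:
  fixes n :: nat
  assumes "2 \<le> n"
  shows "partition_number n = n + (\<Sum>k=3..n. (n - k + 1) * gamma_number k)"
  using assms
proof (induction n rule: dec_induct)
  case base
  show ?case by (simp add: partition_number_2)
next
  case (step n)
  \<comment> \<open>Each old coefficient grows by one; \<open>k \<le> n\<close> keeps the natural
    subtraction from truncating.\<close>
  have "(\<Sum>k=3..n. (Suc n - k + 1) * gamma_number k)
      = (\<Sum>k=3..n. (n - k + 1) * gamma_number k) + (\<Sum>k=3..n. gamma_number k)"
    unfolding sum.distrib[symmetric] by (rule sum.cong) (auto simp: Suc_diff_le)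
  \<comment> \<open>\<open>nuclear_number (Suc n)\<close> supplies all that is new: its 1 advances
    the leading \<open>n\<close>, its terms up to \<open>n\<close> raise the coefficients, and its
    last term is the summand for \<open>k = Suc n\<close>, with coefficient 1.\<close>
  with step show ?case
    using nuclear_number_eq_sum_gamma[of "Suc n"] by (simp add: partition_number_Suc)
qed

end
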